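(* Let $\mathcal F$ be the collection of all non-empty subsets of $\mathbb N$. Let $n\leq 4$ and let $G$ be a digraph with set of nodes $X=\{x_1,\dots,x_n\}$, where $X$ is equipped with an arbitrary topology. Then $G$ is $\mathcal F$-hypercyclic if and only if $G$ is strongly $\mathcal F$-hypercyclic.
   Context: $\mathbb N=\{1,2,3,\dots\}$. A digraph on a finite set $X$ with $|X|>1$ is given by a binary relation $\rho\subseteq X\times X$ with $(x,x)\notin\rho$ for all $x\in X$ (no loops); dynamical properties of $G$ are those of $\rho$. $\rho^n$ is the $n$-fold composition, $\rho^n x:=\{y:(x,y)\in\rho^n\}$, $D(\rho^n):=\{x:\rho^n x\ne\emptyset\}$, $D_\infty(\rho):=\bigcap_{n\in\mathbb N}D(\rho^n)$. $\rho$ is $\mathcal F$-hypercyclic if there is $x\in D_\infty(\rho)$ such that for every non-empty open $V\subseteq X$, $\{n\in\mathbb N:\rho^n x\cap V\neq\emptyset\}\in\mathcal F$. $\rho$ is strongly $\mathcal F$-hypercyclic if there are $x\in D_\infty(\rho)$ and elements $y_n\in\rho^n x$ ($n\in\mathbb N$) such that for every non-empty open $V\subseteq X$, $\{n\in\mathbb N:y_n\in V\}\in\mathcal F$. *)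

theory Defs
  imports "HOL-Analysis.Abstract_Topology"
begin

text \<open>The natural numbers here start at 1: every exponent of a relation below is positive, so the
  convention \<^term>\<open>\<rho> ^^ 0 = Id\<close> (the identity on the whole type) is never used, and families
  consist of subsets of \<^term>\<open>{1::nat..}\<close>.\<close>

definition digraph_on :: "'a set \<Rightarrow> ('a \<times> 'a) set \<Rightarrow> bool" where
  "digraph_on X \<rho> \<longleftrightarrow>
     finite X \<and> card X > 1 \<and> \<rho> \<subseteq> X \<times> X \<and> (\<forall>x\<in>X. (x, x) \<notin> \<rho>)"

definition D_infty :: "('a \<times> 'a) set \<Rightarrow> 'a set" where
  "D_infty \<rho> = (\<Inter>n\<in>{1..}. Domain (\<rho> ^^ n))"

definition hypercyclic :: "nat set set \<Rightarrow> 'a topology \<Rightarrow> ('a \<times> 'a) set \<Rightarrow> bool" where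
  "hypercyclic \<F> T \<rho> \<longleftrightarrow>
     (\<exists>x\<in>D_infty \<rho>. \<forall>V. openin T V \<and> V \<noteq> {} \<longrightarrow>
        {n\<in>{1..}. (\<rho> ^^ n) `` {x} \<inter> V \<noteq> {}} \<in> \<F>)"

text \<open>The points \<open>y n\<close> are chosen independently for each \<open>n\<close>: they need not form
  a walk along \<open>\<rho>\<close>.\<close>

definition strongly_hypercyclic :: "nat set set \<Rightarrow> 'a topology \<Rightarrow> ('a \<times> 'a) set \<Rightarrow> bool" where
  "strongly_hypercyclic \<F> T \<rho> \<longleftrightarrow>
     (\<exists>x\<in>D_infty \<rho>. \<exists>y :: nat \<Rightarrow> 'a. (\<forall>n\<in>{1..}. y n \<in> (\<rho> ^^ n) `` {x}) \<and>
        (\<forall>V. openin T V \<and> V \<noteq> {} \<longrightarrow> {n\<in>{1..}. y n \<in> V} \<in> \<F>))"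

end

theory Submission
  imports Defs
begin

text \<open>Fix \<open>x\<close> in \<^term>\<open>D_infty \<rho>\<close> and consider, for each node, the set of times at which it is
  reached from \<open>x\<close>. Infinitely many times are available for some node, and even for two nodes: if
  there were only one, the orbit would eventually consist of that node alone, which would then
  carry a loop. If \<open>x\<close> itself is reached, then every reached node is reached infinitely often.
  Hence two nodes with finitely many times would force a fifth node. So at most one reached node has
  only finitely many times, and distinct times can be chosen for all reached nodes simultaneously.\<close>

text \<open>Time 0 is excluded, so \<open>hit_times \<rho> x x \<noteq> {}\<close> means a genuine
  return to \<open>x\<close> along a closed walk.\<close>

definition hit_times :: "('a \<times> 'a) set \<Rightarrow> 'a \<Rightarrow> 'a \<Rightarrow> nat set" where
  "hit_times \<rho> x v = {n\<in>{1..}. v \<in> (\<rho> ^^ n) `` {x}}"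

text \<open>Greedy choice: an infinite set still has an element after the finitely many values
  already used are removed. The set \<open>B\<close> reserves values for later use.\<close>

lemma infinite_sets_distinct_representatives:
  assumes "finite S" "\<And>v. v \<in> S \<Longrightarrow> infinite (A v)" "finite B"
  shows "\<exists>f. inj_on f S \<and> (\<forall>v\<in>S. f v \<in> A v - B)"
  using assms
proof (induction S rule: finite_induct)
  case empty
  then show ?case by simp
next
  case (insert u S)
  then obtain f where f: "inj_on f S" "\<forall>v\<in>S. f v \<in> A v - B"
    by auto
  have "infinite (A u - (B \<union> f ` S))"
    using insert by (intro Diff_infinite_finite) auto
  then obtain t where t: "t \<in> A u" "t \<notin> B" "t \<notin> f ` S"
    using infinite_imp_nonempty by blast
  have "f(u := t) ` S = f ` S"
    using insert.hyps by auto
  then have "inj_on (f(u := t)) (insert u S)"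
    using f t insert.hyps by (auto simp: inj_on_def)
  moreover have "\<forall>v\<in>insert u S. (f(u := t)) v \<in> A v - B"
    using f t by auto
  ultimately show ?case by blast
qed

text \<open>A closed walk of length \<open>m\<close> at \<open>x\<close> can be repeated
  \<open>k\<close> times before a walk of length \<open>n\<close> to \<open>v\<close>, giving the
  arbitrarily late times \<open>k * m + n\<close>.\<close>

lemma infinite_hit_times_if_recurrent:
  assumes "hit_times \<rho> x x \<noteq> {}" "hit_times \<rho> x v \<noteq> {}"
  shows "infinite (hit_times \<rho> x v)"
proof -
  obtain m where m: "m \<ge> 1" "(x, x) \<in> \<rho> ^^ m"
    using assms(1) by (auto simp: hit_times_def)
  obtain n where n: "n \<ge> 1" "(x, v) \<in> \<rho> ^^ n"
    using assms(2) by (auto simp: hit_times_def)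
  have loop: "(x, x) \<in> \<rho> ^^ (k * m)" for k
    by (induction k) (use m in \<open>auto simp: relpow_add\<close>)
  have "k * m + n \<in> hit_times \<rho> x v" for k
    using loop[of k] n by (auto simp: hit_times_def relpow_add)
  moreover have "k \<le> k * m + n" for k
    using m by (simp add: trans_le_add1)
  ultimately show ?thesis
    by (metis infinite_nat_iff_unbounded_le)
qed

text \<open>The nodes in \<open>X\<close> with finitely many hit times are finite in number, so
  their times have a common bound, past which none of them is reached.\<close>

lemma orbit_eventually_recurrent:
  assumes "finite X" "\<rho> \<subseteq> X \<times> X"
  obtains N where "\<And>n. n \<ge> N \<Longrightarrow> (\<rho> ^^ n) `` {x} \<subseteq> {v\<in>X. infinite (hit_times \<rho> x v)}"
proof -
  define F where "F = {v\<in>X. finite (hit_times \<rho> x v)}"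
  have "finite (\<Union>v\<in>F. hit_times \<rho> x v)"
    using assms by (auto simp: F_def)
  then obtain N where N: "\<forall>n\<in>(\<Union>v\<in>F. hit_times \<rho> x v). n < N"
    using finite_nat_set_iff_bounded by blast
  show thesis
  proof
    \<comment> \<open>\<open>Suc N\<close> forces \<open>n\<close> to be positive:
      \<open>\<rho> ^^ 0\<close> is the identity on the whole type, and \<open>hit_times\<close>
      ignores time 0.\<close>
    fix n assume n: "n \<ge> Suc N"
    then have "(\<rho> ^^ n) `` {x} \<subseteq> X"
      using assms(2) by (cases n) auto
    moreover have "v \<notin> F" if "v \<in> (\<rho> ^^ n) `` {x}" for v
    proof
      assume "v \<in> F"
      moreover have "n \<in> hit_times \<rho> x v"
        using that n by (simp add: hit_times_def)
      ultimately show False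
        using N n by (meson UN_I Suc_leD not_less)
    qed
    ultimately show "(\<rho> ^^ n) `` {x} \<subseteq> {v\<in>X. infinite (hit_times \<rho> x v)}"
      by (auto simp: F_def)
  qed
qed

lemma two_nodes_infinite_hit_times:
  assumes "digraph_on X \<rho>" "x \<in> D_infty \<rho>"
  obtains c d where "c \<in> X" "d \<in> X" "c \<noteq> d"
    "infinite (hit_times \<rho> x c)" "infinite (hit_times \<rho> x d)"
proof -
  have X: "finite X" "\<rho> \<subseteq> X \<times> X" "\<forall>v\<in>X. (v, v) \<notin> \<rho>"
    using assms(1) by (auto simp: digraph_on_def)
  obtain N where N: "\<And>n. n \<ge> N \<Longrightarrow> (\<rho> ^^ n) `` {x} \<subseteq> {v\<in>X. infinite (hit_times \<rho> x v)}"
    using orbit_eventually_recurrent[OF X(1,2)] by metis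
  \<comment> \<open>The last edge of a walk of length \<open>Suc N\<close> joins nodes reached at
    times \<open>N\<close> and \<open>Suc N\<close>, both late enough; its ends differ because there
    are no loops.\<close>
  have "x \<in> Domain (\<rho> ^^ Suc N)"
    using assms(2) unfolding D_infty_def by (rule INT_D) simp
  then obtain c d where cd: "(x, c) \<in> \<rho> ^^ N" "(c, d) \<in> \<rho>"
    by auto
  then have "(x, d) \<in> \<rho> ^^ Suc N"
    by auto
  then have "c \<in> X" "d \<in> X" "infinite (hit_times \<rho> x c)" "infinite (hit_times \<rho> x d)"
    using N[of N] N[of "Suc N"] cd(1) by auto
  moreover have "c \<noteq> d"
    using cd X by auto
  ultimately show thesis
    using that by blast
qed

text \<open>Otherwise \<open>x\<close>, \<open>v\<close>, \<open>w\<close> and two nodes with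
  infinitely many times would be five distinct nodes.\<close>

lemma finite_hit_times_unique:
  assumes "digraph_on X \<rho>" "card X \<le> 4" "x \<in> D_infty \<rho>"
    and "v \<in> X" "hit_times \<rho> x v \<noteq> {}" "finite (hit_times \<rho> x v)"
    and "w \<in> X" "hit_times \<rho> x w \<noteq> {}" "finite (hit_times \<rho> x w)"
  shows "v = w"
proof (rule ccontr)
  assume "v \<noteq> w"
  obtain c d where cd: "c \<in> X" "d \<in> X" "c \<noteq> d"
    "infinite (hit_times \<rho> x c)" "infinite (hit_times \<rho> x d)"
    using two_nodes_infinite_hit_times[OF assms(1,3)] .
  have "hit_times \<rho> x x = {}"
    using infinite_hit_times_if_recurrent assms(5,6) by metis
  \<comment> \<open>All four nodes are reached from \<open>x\<close>, whereas \<open>x\<close>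
    itself never is.\<close>
  then have "x \<notin> {c, d, v, w}"
    using cd assms by auto
  moreover have "{v, w} \<inter> {c, d} = {}"
    using cd assms by auto
  ultimately have "card {x, c, d, v, w} = 5"
    using \<open>v \<noteq> w\<close> cd(3) by auto
  moreover have "x \<in> X"
  proof -
    have "x \<in> Domain (\<rho> ^^ 1)"
      using assms(3) unfolding D_infty_def by blast
    then show ?thesis
      using assms(1) by (auto simp: digraph_on_def)
  qed
  then have "card {x, c, d, v, w} \<le> card X"
    using assms cd by (intro card_mono) (auto simp: digraph_on_def)
  ultimately show False
    using assms(2) by simp
qed

lemma distinct_hit_times:
  assumes "digraph_on X \<rho>" "card X \<le> 4" "x \<in> D_infty \<rho>"
  shows "\<exists>f. inj_on f {v\<in>X. hit_times \<rho> x v \<noteq> {}} \<and>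
    (\<forall>v\<in>{v\<in>X. hit_times \<rho> x v \<noteq> {}}. f v \<in> hit_times \<rho> x v)"
proof -
  define R where "R = {v\<in>X. hit_times \<rho> x v \<noteq> {}}"
  define S where "S = {v\<in>R. infinite (hit_times \<rho> x v)}"
  have "finite S"
    using assms(1) by (auto simp: S_def R_def digraph_on_def)
  then have reps: "\<exists>f. inj_on f S \<and> (\<forall>v\<in>S. f v \<in> hit_times \<rho> x v - B)" if "finite B" for B
    using that by (intro infinite_sets_distinct_representatives) (auto simp: S_def)
  have "\<exists>f. inj_on f R \<and> (\<forall>v\<in>R. f v \<in> hit_times \<rho> x v)"
  proof (cases "R = S")
    case True
    then show ?thesis
      using reps[of "{}"] by auto
  next
    case False
    then obtain u where u: "u \<in> R" "u \<notin> S"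
      by (auto simp: S_def)
    then have R: "R = insert u S"
      using finite_hit_times_unique[OF assms] by (auto simp: S_def R_def)
    obtain t where t: "t \<in> hit_times \<rho> x u"
      using u by (auto simp: R_def)
    \<comment> \<open>The exceptional node \<open>u\<close> may have no time other than
      \<open>t\<close>, so \<open>t\<close> is fixed first and barred for the nodes in
      \<open>S\<close>.\<close>
    obtain f where f: "inj_on f S" "\<forall>v\<in>S. f v \<in> hit_times \<rho> x v - {t}"
      using reps[of "{t}"] by auto
    have "inj_on (f(u := t)) R"
      using f u unfolding R inj_on_def by auto
    moreover have "\<forall>v\<in>R. (f(u := t)) v \<in> hit_times \<rho> x v"
      using f t unfolding R by auto
    ultimately show ?thesis by blast
  qed
  then show ?thesis
    unfolding R_def .
qed

lemma orbit_selection_hitting_all: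
  assumes "digraph_on X \<rho>" "card X \<le> 4" "x \<in> D_infty \<rho>"
  shows "\<exists>y. (\<forall>n\<ge>1. y n \<in> (\<rho> ^^ n) `` {x}) \<and>
    (\<forall>v\<in>X. hit_times \<rho> x v \<noteq> {} \<longrightarrow> (\<exists>n\<ge>1. y n = v))"
proof -
  define R where "R = {v\<in>X. hit_times \<rho> x v \<noteq> {}}"
  obtain f where f: "inj_on f R" "\<forall>v\<in>R. f v \<in> hit_times \<rho> x v"
    using distinct_hit_times[OF assms] unfolding R_def by blast
  have "\<forall>n\<in>{1..}. \<exists>z. z \<in> (\<rho> ^^ n) `` {x}"
    using assms(3) by (auto simp: D_infty_def)
  then obtain g where g: "\<And>n. n \<ge> 1 \<Longrightarrow> g n \<in> (\<rho> ^^ n) `` {x}"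
    by (metis atLeast_iff)
  \<comment> \<open>At its assigned time each reached node is selected, unambiguously since
    \<open>f\<close> is injective; at all other times any orbit point \<open>g n\<close> will
    do.\<close>
  define y where "y n = (if n \<in> f ` R then the_inv_into R f n else g n)" for n
  have yf: "y (f v) = v" if "v \<in> R" for v
    using that f(1) by (simp add: y_def the_inv_into_f_f)
  have "y n \<in> (\<rho> ^^ n) `` {x}" if n: "n \<ge> 1" for n
  proof (cases "n \<in> f ` R")
    case True
    then show ?thesis
      using f(2) yf by (auto simp: hit_times_def)
  next
    case False
    then show ?thesis
      using g n by (simp add: y_def)
  qed
  moreover have "\<exists>n\<ge>1. y n = v" if "v \<in> X" "hit_times \<rho> x v \<noteq> {}" for v
  proof -
    have "v \<in> R"
      using that by (simp add: R_def)
    then show ?thesis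
      using f(2) yf by (auto simp: hit_times_def)
  qed
  ultimately show ?thesis by blast
qed

theorem proposition3p14:
  fixes X :: "'a set" and \<rho> :: "('a \<times> 'a) set" and T :: "'a topology"
    and \<F> :: "nat set set" and n :: nat
  assumes "\<F> = {A. A \<subseteq> {1..} \<and> A \<noteq> {}}"
    and "n \<le> 4"
    and "card X = n"
    and "digraph_on X \<rho>"
    and "topspace T = X"
  shows "hypercyclic \<F> T \<rho> \<longleftrightarrow> strongly_hypercyclic \<F> T \<rho>"
proof
  assume "hypercyclic \<F> T \<rho>"
  then obtain x where x: "x \<in> D_infty \<rho>"
    and fam: "\<forall>V. openin T V \<and> V \<noteq> {} \<longrightarrow> {n\<in>{1..}. (\<rho> ^^ n) `` {x} \<inter> V \<noteq> {}} \<in> \<F>"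
    unfolding hypercyclic_def by blast
  have hyp: "\<exists>n\<ge>1. (\<rho> ^^ n) `` {x} \<inter> V \<noteq> {}" if "openin T V" "V \<noteq> {}" for V
    using fam that assms(1) by fastforce
  have card: "card X \<le> 4"
    using assms(2,3) by simp
  obtain y where y: "\<forall>n\<ge>1. y n \<in> (\<rho> ^^ n) `` {x}"
    and hit: "\<forall>v\<in>X. hit_times \<rho> x v \<noteq> {} \<longrightarrow> (\<exists>n\<ge>1. y n = v)"
    using orbit_selection_hitting_all[OF assms(4) card x] by blast
  \<comment> \<open>The topology is irrelevant here: an open set met by the orbit contains a reached
    node, and \<open>y\<close> visits every reached node.\<close>
  have "\<exists>n\<ge>1. y n \<in> V" if V: "openin T V" "V \<noteq> {}" for V
  proof -
    obtain n v where "n \<ge> 1" "v \<in> (\<rho> ^^ n) `` {x}" "v \<in> V"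
      using hyp[OF V] by blast
    moreover from this have "hit_times \<rho> x v \<noteq> {}"
      by (auto simp: hit_times_def)
    moreover have "v \<in> X"
      using \<open>v \<in> V\<close> openin_subset[OF V(1)] assms(5) by blast
    ultimately show ?thesis
      using hit by blast
  qed
  then show "strongly_hypercyclic \<F> T \<rho>"
    unfolding strongly_hypercyclic_def
    using x y assms(1) by (intro bexI[of _ x] exI[of _ y]) auto
next
  assume "strongly_hypercyclic \<F> T \<rho>"
  then obtain x y where x: "x \<in> D_infty \<rho>"
    and y: "\<forall>n\<in>{1..}. y n \<in> (\<rho> ^^ n) `` {x}"
    and fam: "\<forall>V. openin T V \<and> V \<noteq> {} \<longrightarrow> {n\<in>{1..}. y n \<in> V} \<in> \<F>"
    unfolding strongly_hypercyclic_def by blast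
  have hit: "\<exists>n\<ge>1. y n \<in> V" if "openin T V" "V \<noteq> {}" for V
    using fam that assms(1) by fastforce
  \<comment> \<open>The point \<open>y n\<close> itself witnesses the intersection.\<close>
  have "\<exists>n\<ge>1. (\<rho> ^^ n) `` {x} \<inter> V \<noteq> {}" if "openin T V" "V \<noteq> {}" for V
    using hit[OF that] y by fastforce
  then show "hypercyclic \<F> T \<rho>"
    unfolding hypercyclic_def using x assms(1) by (intro bexI[of _ x]) auto
qed

end
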